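(* Let $\varepsilon>0$. Then the proportion of sequences $A \in \mathcal{B}_n$ satisfying $$\mu(A) > \sqrt{2n\big(\log n - \log\log n + \log 2 + \varepsilon \big)}$$ is strictly less than $1$ for all sufficiently large $n$.
   Context: A binary sequence of length $n$ is an $n$-tuple $A = (a_0, a_1, \ldots, a_{n-1})$ with each $a_j \in \{+1,-1\}$. $\mathcal{B}_n$ denotes the set of all $2^n$ binary sequences of length $n$. For $0 \le k \le n-1$, the (aperiodic) autocorrelations of $A$ are $c_k = \sum_{j=0}^{n-k-1} a_j a_{j+k}$. For $n \ge 2$, the peak sidelobe level of $A$ is $\mu(A) = \max_{1\le k\le n-1} |c_k|$. The proportion of sequences $A \in \mathcal{B}_n$ with a given property is the number of such sequences divided by $2^n$. Here $\log$ denotes the natural logarithm. *)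

theory Defs
  imports Complex_Main
begin

definition binary_sequences :: "nat \<Rightarrow> int list set" where
  "binary_sequences n = {A. length A = n \<and> set A \<subseteq> {1, -1}}"

definition autocorrelation :: "int list \<Rightarrow> nat \<Rightarrow> int" where
  "autocorrelation A k = (\<Sum>j<length A - k. A ! j * A ! (j + k))"

text \<open>Meaningful only for \<open>length A \<ge> 2\<close>; otherwise the maximum is taken over the empty set.\<close>

definition peak_sidelobe_level :: "int list \<Rightarrow> int" where
  "peak_sidelobe_level A = Max ((\<lambda>k. \<bar>autocorrelation A k\<bar>) ` {1..length A - 1})"

definition proportion :: "nat \<Rightarrow> (int list \<Rightarrow> bool) \<Rightarrow> real" where
  "proportion n P = real (card {A \<in> binary_sequences n. P A}) / 2 ^ n"

end

theory Submission
  imports Defs "HOL-Probability.Hoeffding" "HOL-Real_Asymp.Real_Asymp"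
begin

text \<open>
  The proof is the first moment method. For a uniformly random binary sequence of length
  \<open>n\<close>, the autocorrelation at shift \<open>k \<ge> 1\<close> has the same distribution as a simple random walk
  with \<open>n - k\<close> steps, even though its summands share entries: its moment generating function is
  exactly \<open>cosh t ^ (n - k)\<close> (\<open>sum_exp_autocorrelation\<close>). The Chernoff bound therefore gives
  probability at most \<open>2 exp (-\<theta>\<^sup>2 / (2(n-k)))\<close> for \<open>|c_k| > \<theta>\<close> (\<open>card_autocorrelation_gt_le\<close>).

  With \<open>\<theta> = sqrt (2nL)\<close> the right-hand side is \<open>2 exp (-L n/(n-k)) \<le> 2 exp (-L) exp (-L k/n)\<close>.
  It matters that the decay in \<open>k\<close> is retained here: summed over \<open>k\<close>, these bounds form a
  geometric series with total at most \<open>2 exp (-L) n/L\<close> (\<open>proportion_peak_sidelobe_level_le\<close>),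
  which saves a factor \<open>L \<approx> log n\<close> over bounding each term by \<open>2 exp (-L)\<close>. That factor is the
  source of the \<open>- log log n\<close> in the threshold. For \<open>L = log n - log log n + log 2 + \<epsilon>\<close> the bound
  equals \<open>exp (-\<epsilon>) log n / L\<close>, which tends to \<open>exp (-\<epsilon>) < 1\<close>.
\<close>

section \<open>Binary sequences and the moment generating function of an autocorrelation\<close>

lemma finite_binary_sequences [simp]: "finite (binary_sequences n)"
  using finite_lists_length_eq[of "{1, -1 :: int}" n]
  by (simp add: binary_sequences_def conj_commute)

lemma binary_sequences_0: "binary_sequences 0 = {[]}"
  by (auto simp: binary_sequences_def)

lemma length_binary_sequences: "A \<in> binary_sequences n \<Longrightarrow> length A = n"
  by (simp add: binary_sequences_def)

lemma sum_binary_sequences_Suc: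
  "(\<Sum>A\<in>binary_sequences (Suc n). f A) = (\<Sum>A\<in>binary_sequences n. f (1 # A) + f (-1 # A))"
proof -
  have split: "binary_sequences (Suc n) =
      (#) 1 ` binary_sequences n \<union> (#) (-1) ` binary_sequences n"
    by (auto simp: binary_sequences_def length_Suc_conv)
  have "(\<Sum>A\<in>binary_sequences (Suc n). f A) =
      sum f ((#) 1 ` binary_sequences n) + sum f ((#) (-1) ` binary_sequences n)"
    unfolding split by (rule sum.union_disjoint) auto
  then show ?thesis
    by (simp add: sum.reindex sum.distrib)
qed

lemma card_binary_sequences: "card (binary_sequences n) = 2 ^ n"
proof (induction n)
  case (Suc n)
  then show ?case
    using sum_binary_sequences_Suc[of "\<lambda>_. 1 :: nat" n] by simp
qed (simp add: binary_sequences_0)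

lemma autocorrelation_Cons:
  assumes "1 \<le> k" "k \<le> length A"
  shows "autocorrelation (a # A) k = a * A ! (k - 1) + autocorrelation A k"
proof -
  have "autocorrelation (a # A) k = (\<Sum>j<Suc (length A - k). (a # A) ! j * (a # A) ! (j + k))"
    using assms by (simp add: autocorrelation_def Suc_diff_le)
  also have "\<dots> = a * A ! (k - 1) + autocorrelation A k"
    unfolding sum.lessThan_Suc_shift using assms by (simp add: autocorrelation_def nth_Cons')
  finally show ?thesis .
qed

text \<open>
  Prepending an entry \<open>a\<close> adds the term \<open>a * A ! (k - 1)\<close> to the autocorrelation. When \<open>a\<close> runs
  over both signs, so does this term, whatever the sign of \<open>A ! (k - 1)\<close>. Hence each of the \<open>m\<close>
  summands of the autocorrelation contributes a factor \<open>2 cosh t\<close> as if the summands were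
  independent; the remaining \<open>k\<close> entries only count sequences.
\<close>

lemma sum_exp_autocorrelation:
  assumes "1 \<le> k"
  shows "(\<Sum>A\<in>binary_sequences (k + m). exp (t * real_of_int (autocorrelation A k)))
    = 2 ^ (k + m) * cosh t ^ m"
proof (induction m)
  case 0
  have "(\<Sum>A\<in>binary_sequences k. exp (t * real_of_int (autocorrelation A k))) =
      (\<Sum>A\<in>binary_sequences k. 1)"
    by (rule sum.cong) (auto simp: autocorrelation_def length_binary_sequences)
  then show ?case
    by (simp add: card_binary_sequences)
next
  case (Suc m)
  let ?E = "\<lambda>A. exp (t * real_of_int (autocorrelation A k))"
  have step: "?E (1 # A) + ?E (-1 # A) = 2 * cosh t * ?E A"
    if "A \<in> binary_sequences (k + m)" for A
  proof -
    have len: "length A = k + m"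
      using that by (rule length_binary_sequences)
    then have "A ! (k - 1) \<in> set A"
      using assms by (intro nth_mem) simp
    then have "A ! (k - 1) = 1 \<or> A ! (k - 1) = -1"
      using that by (auto simp: binary_sequences_def)
    moreover have "exp (t * (1 + real_of_int (autocorrelation A k))) = exp t * ?E A"
      "exp (t * (-1 + real_of_int (autocorrelation A k))) = exp (- t) * ?E A"
      by (simp_all only: distrib_left exp_add mult_1_right mult_minus_right)
    moreover have "2 * cosh t * ?E A = exp t * ?E A + exp (- t) * ?E A"
      by (simp add: cosh_field_def distrib_right)
    ultimately show ?thesis
      using assms len by (auto simp: autocorrelation_Cons add.commute)
  qed
  have "(\<Sum>A\<in>binary_sequences (k + Suc m). ?E A) = (\<Sum>A\<in>binary_sequences (k + m). 2 * cosh t * ?E A)"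
    by (simp add: sum_binary_sequences_Suc step)
  also have "\<dots> = 2 ^ (k + Suc m) * cosh t ^ Suc m"
    by (simp add: Suc sum_distrib_left[symmetric])
  finally show ?case .
qed

section \<open>A Chernoff bound for a single autocorrelation\<close>

text \<open>
  This is Hoeffding's lemma for a fair sign: the logarithm bounded there is \<open>ln (cosh x)\<close> when
  \<open>p = 1/2\<close> and \<open>h = 2x\<close>.
\<close>

lemma cosh_le_exp_half_square:
  assumes "(x :: real) \<ge> 0"
  shows "cosh x \<le> exp (x\<^sup>2 / 2)"
proof -
  have pos: "1 + 1 / 2 * (exp (2 * x) - 1) > 0"
    by (simp add: field_simps add_pos_pos)
  have "- (2 * x) * (1 / 2) + ln (1 + 1 / 2 * (exp (2 * x) - 1)) \<le> (2 * x)\<^sup>2 / 8"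
    by (rule Hoeffdings_lemma_aux) (use assms in auto)
  then have "exp (- x + ln (1 + 1 / 2 * (exp (2 * x) - 1))) \<le> exp (x\<^sup>2 / 2)"
    by (simp add: power_mult_distrib)
  moreover have "exp (- x + ln (1 + 1 / 2 * (exp (2 * x) - 1))) = exp (- x) * (1 + 1 / 2 * (exp (2 * x) - 1))"
    using pos by (simp only: exp_add exp_ln)
  moreover have "exp (- x) * (1 + 1 / 2 * (exp (2 * x) - 1)) = cosh x"
    unfolding exp_double power2_eq_square by (simp add: cosh_field_def field_simps exp_minus)
  ultimately show ?thesis
    by (simp only:)
qed

text \<open>
  Markov's inequality for \<open>exp (t c) + exp (-t c)\<close>, which handles both tails at once, with
  \<open>t = \<theta>/m\<close>, the minimizer of \<open>m t\<^sup>2 / 2 - t \<theta>\<close>.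
\<close>

lemma card_autocorrelation_gt_le:
  assumes "1 \<le> k" "1 \<le> m" "0 \<le> \<theta>"
  shows "real (card {A \<in> binary_sequences (k + m). \<theta> < \<bar>real_of_int (autocorrelation A k)\<bar>})
    \<le> 2 ^ (k + m) * (2 * exp (- (\<theta>\<^sup>2 / (2 * real m))))"
proof -
  define t where "t = \<theta> / real m"
  let ?c = "\<lambda>A. real_of_int (autocorrelation A k)"
  let ?S = "{A \<in> binary_sequences (k + m). \<theta> < \<bar>?c A\<bar>}"
  have t: "t \<ge> 0"
    using assms by (simp add: t_def)
  have "real (card ?S) * exp (t * \<theta>) = (\<Sum>A\<in>?S. exp (t * \<theta>))"
    by simp
  also have "\<dots> \<le> (\<Sum>A\<in>?S. exp (t * ?c A) + exp (- t * ?c A))"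
  proof (rule sum_mono)
    fix A assume "A \<in> ?S"
    then have "exp (t * \<theta>) \<le> exp (t * \<bar>?c A\<bar>)"
      using t by (simp add: mult_left_mono)
    also have "\<dots> \<le> exp (t * ?c A) + exp (- t * ?c A)"
      by (simp add: abs_if)
    finally show "exp (t * \<theta>) \<le> exp (t * ?c A) + exp (- t * ?c A)" .
  qed
  also have "\<dots> \<le> (\<Sum>A\<in>binary_sequences (k + m). exp (t * ?c A) + exp (- t * ?c A))"
    by (rule sum_mono2) (auto intro: add_nonneg_nonneg)
  also have "\<dots> = 2 ^ (k + m) * (2 * cosh t ^ m)"
    unfolding sum.distrib sum_exp_autocorrelation[OF assms(1)] by simp
  also have "\<dots> \<le> 2 ^ (k + m) * (2 * exp (t\<^sup>2 / 2) ^ m)"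
    by (intro mult_left_mono power_mono cosh_le_exp_half_square t) auto
  also have "exp (t\<^sup>2 / 2) ^ m = exp (- (\<theta>\<^sup>2 / (2 * real m))) * exp (t * \<theta>)"
  proof -
    have "real m * (t\<^sup>2 / 2) = - (\<theta>\<^sup>2 / (2 * real m)) + t * \<theta>"
      using assms by (simp add: t_def field_simps power2_eq_square)
    then show ?thesis
      by (simp only: exp_of_nat_mult[symmetric] exp_add[symmetric])
  qed
  finally have "real (card ?S) * exp (t * \<theta>)
      \<le> 2 ^ (k + m) * (2 * exp (- (\<theta>\<^sup>2 / (2 * real m)))) * exp (t * \<theta>)"
    by (simp only: mult.assoc)
  then show ?thesis
    by (rule mult_right_le_imp_le) simp
qed

section \<open>The union bound over all shifts\<close>

lemma sum_exp_minus_mult_le: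
  assumes "(x :: real) > 0"
  shows "(\<Sum>k=1..N. exp (- (x * real k))) \<le> 1 / x"
proof -
  define q where "q = exp (- x)"
  have q: "0 < q" "q < 1"
    using assms by (auto simp: q_def)
  have "(\<Sum>k=1..N. exp (- (x * real k))) = (\<Sum>k=1..N. q ^ k)"
    by (simp add: q_def exp_of_nat_mult[symmetric] mult.commute)
  also have "\<dots> = q * (\<Sum>k<N. q ^ k)"
    by (simp add: sum.atLeast1_atMost_eq sum_distrib_left)
  also have "\<dots> = q * (1 - q ^ N) / (1 - q)"
    using q by (simp add: sum_gp_strict)
  also have "\<dots> \<le> q / (1 - q)"
    using q by (intro divide_right_mono) (auto simp: mult_le_cancel_left1)
  also have "\<dots> \<le> 1 / x"
  proof -
    have "q * (1 + x) \<le> q * exp x"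
      using q by (intro mult_left_mono exp_ge_add_one_self) auto
    also have "q * exp x = 1"
      by (simp add: q_def exp_minus)
    finally show ?thesis
      using q assms by (simp add: field_simps)
  qed
  finally show ?thesis .
qed

text \<open>
  Shift \<open>k\<close> has tail exponent \<open>L n/(n-k)\<close>. Bounding it below by its tangent \<open>L (1 + k/n)\<close> at
  \<open>k = 0\<close> turns the sum over shifts into a geometric series with ratio \<open>exp (-L/n)\<close>.
\<close>

lemma proportion_peak_sidelobe_level_le:
  assumes "2 \<le> n" "0 < L"
  shows "proportion n (\<lambda>A. real_of_int (peak_sidelobe_level A) > sqrt (2 * real n * L))
    \<le> 2 * exp (- L) * (real n / L)"
proof -
  define \<theta> where "\<theta> = sqrt (2 * real n * L)"
  let ?S = "\<lambda>k. {A \<in> binary_sequences n. \<theta> < \<bar>real_of_int (autocorrelation A k)\<bar>}"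
  have card_S: "real (card (?S k)) \<le> 2 ^ n * (2 * exp (- L) * exp (- (L / real n * real k)))"
    if k: "k \<in> {1..n - 1}" for k
  proof -
    have n: "k + (n - k) = n" "1 \<le> n - k" "1 \<le> k" "0 \<le> \<theta>"
      using k assms by (auto simp: \<theta>_def)
    have "real (card (?S k)) \<le> 2 ^ n * (2 * exp (- (\<theta>\<^sup>2 / (2 * real (n - k)))))"
      using card_autocorrelation_gt_le[OF n(3,2,4)] by (simp only: n(1))
    also have "\<theta>\<^sup>2 / (2 * real (n - k)) = L * (real n / real (n - k))"
      using assms by (simp add: \<theta>_def)
    also have "exp (- (L * (real n / real (n - k)))) \<le> exp (- (L * (1 + real k / real n)))"
    proof -
      have "(1 + real k / real n) * real (n - k) \<le> real n"
        using n assms by (simp add: field_simps power2_eq_square)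
      then have "1 + real k / real n \<le> real n / real (n - k)"
        using n by (simp add: field_simps)
      then have "L * (1 + real k / real n) \<le> L * (real n / real (n - k))"
        using assms by (intro mult_left_mono) auto
      then show ?thesis
        by (simp only: exp_le_cancel_iff neg_le_iff_le)
    qed
    also have "exp (- (L * (1 + real k / real n))) = exp (- L) * exp (- (L / real n * real k))"
      by (simp add: exp_add[symmetric] algebra_simps)
    finally show ?thesis
      by (simp add: mult.assoc)
  qed
  have "{A \<in> binary_sequences n. real_of_int (peak_sidelobe_level A) > \<theta>} \<subseteq> (\<Union>k\<in>{1..n - 1}. ?S k)"
  proof
    fix A assume A: "A \<in> {A \<in> binary_sequences n. real_of_int (peak_sidelobe_level A) > \<theta>}"
    then have "length A = n"
      by (simp add: length_binary_sequences)
    \<comment> \<open>For \<open>n \<ge> 2\<close> there is at least one shift, so the maximum is attained.\<close>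
    then have "peak_sidelobe_level A \<in> (\<lambda>k. \<bar>autocorrelation A k\<bar>) ` {1..n - 1}"
      using assms unfolding peak_sidelobe_level_def by (metis (no_types, lifting) Max_in
          finite_imageI finite_atLeastAtMost image_is_empty atLeastatMost_empty_iff
          One_nat_def Suc_1 diff_Suc_1 diff_le_mono)
    then show "A \<in> (\<Union>k\<in>{1..n - 1}. ?S k)"
      using A by auto
  qed
  then have "card {A \<in> binary_sequences n. real_of_int (peak_sidelobe_level A) > \<theta>}
      \<le> card (\<Union>k\<in>{1..n - 1}. ?S k)"
    by (intro card_mono) auto
  also have "\<dots> \<le> (\<Sum>k=1..n - 1. card (?S k))"
    by (rule card_UN_le) simp
  finally have "real (card {A \<in> binary_sequences n. real_of_int (peak_sidelobe_level A) > \<theta>})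
      \<le> (\<Sum>k=1..n - 1. real (card (?S k)))"
    by (simp only: of_nat_sum[symmetric] of_nat_le_iff)
  also have "\<dots> \<le> (\<Sum>k=1..n - 1. 2 ^ n * (2 * exp (- L) * exp (- (L / real n * real k))))"
    by (rule sum_mono) (rule card_S)
  also have "\<dots> = 2 ^ n * (2 * exp (- L)) * (\<Sum>k=1..n - 1. exp (- (L / real n * real k)))"
    by (simp only: sum_distrib_left mult.assoc)
  also have "\<dots> \<le> 2 ^ n * (2 * exp (- L)) * (1 / (L / real n))"
    using assms by (intro mult_left_mono sum_exp_minus_mult_le) auto
  finally show ?thesis
    by (simp add: proportion_def \<theta>_def field_simps)
qed

theorem corollary3:
  fixes \<epsilon> :: real
  assumes "\<epsilon> > 0"
  shows "\<forall>\<^sub>F n in sequentially.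
    proportion n (\<lambda>A. real_of_int (peak_sidelobe_level A) >
      sqrt (2 * real n * (ln (real n) - ln (ln (real n)) + ln 2 + \<epsilon>))) < 1"
proof -
  define c where "c = ln 2 + \<epsilon>"
  define L where "L = (\<lambda>n. ln (real n) - ln (ln (real n)) + c)"
  have "(\<lambda>n. ln (real n) / L n) \<longlonglongrightarrow> 1"
    unfolding L_def by real_asymp
  then have "(\<lambda>n. exp (- \<epsilon>) * (ln (real n) / L n)) \<longlonglongrightarrow> exp (- \<epsilon>) * 1"
    by (intro tendsto_intros)
  moreover have "exp (- \<epsilon>) * 1 < 1"
    using assms by simp
  ultimately have "\<forall>\<^sub>F n in sequentially. exp (- \<epsilon>) * (ln (real n) / L n) < 1"
    by (rule order_tendstoD)
  moreover have "\<forall>\<^sub>F n in sequentially. L n > 0"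
    unfolding L_def by real_asymp
  moreover have "\<forall>\<^sub>F n in sequentially. ln (real n) > 0"
    by real_asymp
  ultimately show ?thesis
    using eventually_ge_at_top[of 2]
  proof eventually_elim
    case (elim n)
    have "proportion n (\<lambda>A. real_of_int (peak_sidelobe_level A) > sqrt (2 * real n * L n))
        \<le> 2 * exp (- L n) * (real n / L n)"
      using elim by (intro proportion_peak_sidelobe_level_le)
    also have "2 * exp (- L n) * (real n / L n) = exp (- \<epsilon>) * (ln (real n) / L n)"
    proof -
      have "- L n = ln (ln (real n)) + - ln (real n) + - ln 2 + - \<epsilon>"
        by (simp add: L_def c_def)
      then have "exp (- L n) =
          exp (ln (ln (real n))) * exp (- ln (real n)) * exp (- ln 2) * exp (- \<epsilon>)"
        by (simp only: exp_add)
      also have "\<dots> = ln (real n) / (2 * real n) * exp (- \<epsilon>)"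
      proof -
        have n_eqs: "exp (ln (ln (real n))) = ln (real n)" "exp (- ln (real n)) = 1 / real n"
          using elim(3,4) by (simp_all add: exp_minus inverse_eq_divide)
        have two_eq: "exp (- ln 2) = (1 / 2 :: real)"
          by (simp add: exp_minus)
        show ?thesis
          unfolding n_eqs two_eq by simp
      qed
      finally have "exp (- L n) = ln (real n) / (2 * real n) * exp (- \<epsilon>)" .
      then show ?thesis
        using elim(4) by simp
    qed
    also have "\<dots> < 1"
      using elim by simp
    finally show ?case
      by (simp add: L_def c_def algebra_simps)
  qed
qed

end
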